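(* Let $n\geqslant 2$ be an integer. Then \[ \sum_{k=0}^{n-1}[3k+1]_q{2k\brack k}_q^3(-q^{k+1};q)_{n-k-1}^4q^{-{k+1\choose 2}}\equiv0\pmod{(1+q^{n-1})^2[n]_q{2n-1\brack n-1}_q}. \]
   Context: For an indeterminate $q$ and a nonnegative integer $m$, $(a;q)_m=(1-a)(1-aq)\cdots(1-aq^{m-1})$ (with $(a;q)_0=1$); $[m]_q=1+q+\cdots+q^{m-1}$; ${m\brack k}_q=\frac{(q;q)_m}{(q;q)_k(q;q)_{m-k}}$. For rational functions $A,B$ in $q$ and a polynomial $P(q)$, $A\equiv B\pmod{P}$ means $A-B=P(q)U(q)/V(q)$ with $U,V$ polynomials and $V$ relatively prime to $P$. *)

theory Defs
  imports "HOL-Computational_Algebra.Computational_Algebra"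
begin

text \<open>
  Rational functions are elements of \<^typ>\<open>rat poly fract\<close>, the fraction field of the
  polynomials in one indeterminate over the rationals.
\<close>

definition q_indet :: "rat poly fract" where
  "q_indet = to_fract [:0, 1:]"

definition q_pochhammer :: "'a :: comm_ring_1 \<Rightarrow> 'a \<Rightarrow> nat \<Rightarrow> 'a" where
  "q_pochhammer a q m = (\<Prod>i<m. 1 - a * q ^ i)"

definition q_int :: "'a :: comm_ring_1 \<Rightarrow> nat \<Rightarrow> 'a" where
  "q_int q m = (\<Sum>i<m. q ^ i)"

definition q_binomial :: "'a :: field \<Rightarrow> nat \<Rightarrow> nat \<Rightarrow> 'a" where
  "q_binomial q m k =
     (if k \<le> m then q_pochhammer q q m / (q_pochhammer q q k * q_pochhammer q q (m - k)) else 0)"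

text \<open>
  The modulus is passed as a rational function, because Gaussian binomials are quotients in the
  fraction field; the congruence asserts that the modulus is a polynomial.
\<close>

definition ratfun_cong :: "rat poly fract \<Rightarrow> rat poly fract \<Rightarrow> rat poly fract \<Rightarrow> bool" where
  "ratfun_cong A B M \<longleftrightarrow>
     (\<exists>P U V. M = to_fract P \<and> V \<noteq> 0 \<and> coprime V P \<and>
        A - B = to_fract P * to_fract U / to_fract V)"

end

theory Submission
  imports Defs
begin

text \<open>
  Write \<open>n = m + 1\<close>. After clearing powers of \<open>q\<close>, divisibility is checked by comparing orders at
  each complex number \<open>z\<close>; only primitive \<open>d\<close>-th roots of unity with \<open>d \<ge> 2\<close> and
  \<open>d \<le> 2 (m mod d) + 1\<close> are roots of the modulus, with order at most 3, and order 1 if \<open>d\<close> is odd.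

  For even \<open>d\<close> every summand has order at least 3: either the central Gaussian binomial vanishes
  at \<open>z\<close> or one of the factors \<open>1 + q\<^sup>i\<close> does.

  For odd \<open>d = 2 h + 1\<close> the sum at \<open>z\<close> splits into blocks of length \<open>d\<close>, each a multiple of
  \<open>S(z)\<close>, where \<open>S(a)\<close> is the sum over \<open>k \<le> h\<close> of
  \<open>(1 - a q\<^sup>3\<^sup>k) (q;q\<^sup>2)\<^sub>k (a;q\<^sup>2)\<^sub>k\<^sup>2 / ((q\<^sup>2;q\<^sup>2)\<^sub>k (q;q)\<^sub>k\<^sup>2 q\<^sup>k\<^sup>(\<^sup>k\<^sup>-\<^sup>1\<^sup>)\<^sup>/\<^sup>2 a\<^sup>k)\<close> at \<open>q = z\<close>.
  A WZ-type telescoping gives \<open>S(a z\<^sup>2) = z S(a)\<close>. Since \<open>S(1) = 0\<close> trivially and \<open>z\<close> is an even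
  power of itself, \<open>S(z) = 0\<close>.
\<close>

section \<open>A telescoping sum at odd roots of unity\<close>

text \<open>The \<open>a\<close>-free part
  \<open>(q;q^2)_k / ((q^2;q^2)_k (q;q)_k^2 q^(k(k-1)/2))\<close>, as a product so that consecutive
  values differ by a single factor.\<close>

definition wz_coeff :: "'a::field \<Rightarrow> nat \<Rightarrow> 'a" where
  "wz_coeff q k = (\<Prod>i<k. (1 - q ^ (2*i+1)) / ((1 - q ^ (2*i+2)) * (1 - q ^ (i+1))\<^sup>2 * q ^ i))"

text \<open>
  At \<open>a = q\<close> this is \<open>1 - q\<close> times the original summand, up to a factor independent of \<open>k\<close>.
  The free parameter \<open>a\<close> is what makes the sum telescope under \<open>a \<mapsto> a q\<^sup>2\<close>.
\<close>

definition wz_term :: "'a::field \<Rightarrow> 'a \<Rightarrow> nat \<Rightarrow> 'a" where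
  "wz_term q a k = (1 - a * q ^ (3*k)) * wz_coeff q k * (\<Prod>i<k. 1 - a * q ^ (2*i))\<^sup>2 / a ^ k"

lemma one_minus_even_power:
  fixes a :: "'a::comm_ring_1"
  shows "1 - a ^ (2 * m) = (1 - a ^ m) * (1 + a ^ m)"
proof -
  have "a ^ (2 * m) = a ^ m * a ^ m" by (simp only: mult_2 power_add)
  then show ?thesis by (simp only:) (simp add: algebra_simps)
qed

text \<open>One telescoping step with \<open>x = q^k\<close> and common factors removed: the
  right-hand side is the difference of the closed form in \<open>wz_sum\<close> at \<open>k\<close>
  and at \<open>k - 1\<close>.\<close>

lemma wz_identity:
  fixes q a x :: "'a::field"
  assumes "q \<noteq> 0" "x \<noteq> 0"
  shows "(1 - a*q^2*x^3) * (1 - a*x^2)^2 / (q * x^2) - (1 - a*x^3) * (1-a)^2 =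
    (1 - q*x^2) * (1/(q*x) + a) / x * (1 - a*x^2)^2 - a * (1 - x^2) * (1-x)^2 * (1/x + a)"
proof -
  have "(1 - a*q^2*x^3) * (1 - a*x^2)^2 - q*x^2*((1 - a*x^3) * (1-a)^2) =
    (1 - q*x^2) * (1 + a*q*x) * (1 - a*x^2)^2 - q*x*(a * (1 - x^2) * (1-x)^2 * (1 + a*x))"
    by algebra
  then have "((1 - a*q^2*x^3) * (1 - a*x^2)^2 - q*x^2*((1 - a*x^3) * (1-a)^2)) / (q*x^2) =
    ((1 - q*x^2) * (1 + a*q*x) * (1 - a*x^2)^2 - q*x*(a * (1 - x^2) * (1-x)^2 * (1 + a*x))) / (q*x^2)"
    by (rule arg_cong)
  moreover have "1/(q*x) + a = (1 + a*q*x) / (q*x)" "1/x + a = (1 + a*x) / x"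
    using assms by (simp_all add: field_simps)
  ultimately show ?thesis
    using assms by (simp add: diff_divide_distrib power2_eq_square mult.assoc)
qed

text \<open>Induction on \<open>m\<close> via \<open>wz_identity\<close>. What matters later is the
  factor \<open>1 - q^(2*m+1)\<close>, which kills the closed form when \<open>q\<close> has order
  \<open>2*m+1\<close>.\<close>

lemma wz_sum:
  fixes q a :: "'a::field"
  assumes "q \<noteq> 0" "a \<noteq> 0" and "\<And>i. i < m \<Longrightarrow> q ^ (i+1) \<noteq> 1 \<and> q ^ (2*i+2) \<noteq> 1"
  shows "(\<Sum>k\<le>m. wz_term q (a * q\<^sup>2) k / q - wz_term q a k) =
    (1 - q ^ (2*m+1)) * (1 / (q * q^m) + a) / q^m * wz_coeff q m
      * (\<Prod>i<m. 1 - a * q ^ (2*i+2))\<^sup>2 / a ^ m"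
  using assms(3)
proof (induction m)
  case 0
  show ?case using assms(1,2) by (simp add: wz_term_def wz_coeff_def field_simps power2_eq_square)
next
  case (Suc m)
  define x where "x = q ^ Suc m"
  \<comment> \<open>\<open>D\<close> is shared by the products at \<open>a\<close> and at
    \<open>a q^2\<close>, which are \<open>(1 - a) D\<close> and
    \<open>D (1 - a x^2)\<close>.\<close>
  define D where "D = (\<Prod>i<m. 1 - a * q ^ (2*i+2))"
  define c where "c = wz_coeff q (Suc m)"
  have x0: "x \<noteq> 0" using assms by (simp add: x_def)
  have qm: "q ^ m = x / q" using assms by (simp add: x_def)
  have e1: "q ^ (2*m+1) = x^2 / q" "q ^ (2*m+2) = x^2" "q ^ (2 * Suc m) = x^2" "q ^ (2 * Suc m + 1) = q * x^2"
     "q ^ (3 * Suc m) = x^3" "q ^ (m+1) = x"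
    using assms(1) by (simp_all add: x_def power2_eq_square power3_eq_cube power_add mult_2 mult_2_right numeral_3_eq_3 ac_simps)
  have x1: "1 - x \<noteq> 0" and x2: "1 - x^2 \<noteq> 0"
    using Suc.prems[of m] unfolding e1 by auto
  have c: "wz_coeff q m * (1 - x^2 / q) = c * ((1 - x^2) * (1 - x)^2 * (x / q))"
    using x0 x1 x2 assms(1) unfolding c_def wz_coeff_def prod.lessThan_Suc e1 qm by simp
  have p1: "(\<Prod>i<Suc m. 1 - a * q ^ (2*i)) = (1 - a) * D"
    unfolding prod.lessThan_Suc_shift D_def by simp
  have e0: "q ^ (2 * m) = q ^ m * q ^ m" by (simp only: mult_2 power_add)
  have p2: "(\<Prod>i<Suc m. 1 - a * q^2 * q ^ (2*i)) = D * (1 - a * x^2)"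
    unfolding prod.lessThan_Suc D_def e0 by (simp add: x_def power2_eq_square ac_simps)
  have p3: "(\<Prod>i<Suc m. 1 - a * q ^ (2*i+2)) = D * (1 - a * x^2)"
    unfolding prod.lessThan_Suc D_def by (simp only: e1)
  have apq: "(a * q^2) ^ Suc m = a ^ Suc m * x^2"
    by (simp add: x_def power_mult_distrib power2_eq_square)
  have "(\<Sum>k\<le>m. wz_term q (a * q\<^sup>2) k / q - wz_term q a k) =
      (1 - x^2/q) * (1/(q * (x/q)) + a) / (x/q) * wz_coeff q m * D^2 / a ^ m"
    using Suc.IH[OF Suc.prems[OF less_SucI]] unfolding D_def e1 qm .
  then have IH: "(\<Sum>k\<le>m. wz_term q (a * q\<^sup>2) k / q - wz_term q a k) =
      (1/x + a) / (x / q) * (wz_coeff q m * (1 - x^2/q)) * D^2 / a ^ m"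
    using assms(1) by (simp add: mult.commute mult.left_commute)
  also have "\<dots> = (c * D^2 / a ^ Suc m) * (a * (1 - x^2) * (1-x)^2 * (1/x + a))"
    unfolding c using x0 assms by (simp add: field_simps)
  finally have IH': "(\<Sum>k\<le>m. wz_term q (a * q\<^sup>2) k / q - wz_term q a k) =
     (c * D^2 / a ^ Suc m) * (a * (1 - x^2) * (1-x)^2 * (1/x + a))" .
  have t: "wz_term q (a * q\<^sup>2) (Suc m) / q - wz_term q a (Suc m) =
     (c * D^2 / a ^ Suc m) * ((1 - a*q^2*x^3) * (1 - a*x^2)^2 / (q * x^2) - (1 - a*x^3) * (1-a)^2)"
  proof -
    have "P * c * (D * A)^2 / (K * x^2) / q - R * c * (B * D)^2 / K =
        (c * D^2 / K) * (P * A^2 / (q * x^2) - R * B^2)" for P R A B K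
      by (simp add: power_mult_distrib right_diff_distrib ac_simps)
    then show ?thesis unfolding wz_term_def p1 p2 apq e1 c_def[symmetric] by this
  qed
  have "(\<Sum>k\<le>Suc m. wz_term q (a * q\<^sup>2) k / q - wz_term q a k) =
     (c * D^2 / a ^ Suc m) * ((1 - q*x^2) * (1/(q*x) + a) / x * (1 - a*x^2)^2)"
    unfolding sum.atMost_Suc IH' t wz_identity[OF assms(1) x0] by (simp add: algebra_simps)
  also have "\<dots> = (1 - q * x^2) * (1/(q*x) + a) / x * c * (D * (1 - a*x^2))\<^sup>2 / a ^ Suc m"
    by (simp add: power_mult_distrib ac_simps)
  finally show ?case unfolding p3 e1 c_def[symmetric] x_def[symmetric] .
qed

lemma wz_sum_root:
  fixes q :: "'a::field"
  assumes d: "d = 2*m+1" and root: "\<And>i. q ^ i = 1 \<longleftrightarrow> d dvd i"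
  shows "(\<Sum>k\<le>m. wz_term q q k) = 0"
proof -
  have q0: "q \<noteq> 0"
  proof
    assume "q = 0" moreover have "q ^ d = 1" using root by simp
    ultimately show False using d by simp
  qed
  \<comment> \<open>Both exponents lie strictly between 0 and \<open>d\<close>.\<close>
  have nz: "q ^ (i+1) \<noteq> 1 \<and> q ^ (2*i+2) \<noteq> 1" if "i < m" for i
  proof -
    have "\<not> d dvd i + 1" "\<not> d dvd 2*i+2" using that d by (auto dest!: dvd_imp_le)
    then show ?thesis by (simp only: root) simp
  qed
  have step: "(\<Sum>k\<le>m. wz_term q (a * q\<^sup>2) k) = q * (\<Sum>k\<le>m. wz_term q a k)" if "a \<noteq> 0" for a
  proof -
    have "q ^ (2*m+1) = 1" unfolding root d by simp
    then have "(\<Sum>k\<le>m. wz_term q (a * q\<^sup>2) k / q - wz_term q a k) = 0"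
      using wz_sum[OF q0 that nz] by simp
    then show ?thesis
      using q0 by (simp add: sum_subtractf flip: sum_divide_distrib) (simp add: field_simps)
  qed
  \<comment> \<open>From \<open>a = 1\<close>, where every term vanishes, to \<open>a = q\<^sup>2\<^sup>(\<^sup>m\<^sup>+\<^sup>1\<^sup>) = q\<close>.\<close>
  have "(\<Sum>k\<le>m. wz_term q (q ^ (2*j)) k) = 0" for j
  proof (induction j)
    case 0
    \<comment> \<open>For \<open>k = 0\<close> the factor \<open>1 - a q^(3*k)\<close> is 0; for
      \<open>k > 0\<close> the factor \<open>i = 0\<close> of the product is.\<close>
    have "wz_term q 1 k = 0" for k
      by (cases k) (simp_all add: wz_term_def prod.lessThan_Suc_shift del: prod.lessThan_Suc)
    then show ?case by simp
  next
    case (Suc j)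
    then show ?case using step[of "q ^ (2*j)"] q0
      by (simp add: power_add[symmetric] flip: power_Suc)
  qed
  from this[of "m+1"] have "(\<Sum>k\<le>m. wz_term q (q ^ (2*m+1) * q) k) = 0" by (simp add: ac_simps)
  moreover have "q ^ (2*m+1) = 1" unfolding root d by simp
  ultimately show ?thesis by (simp only: mult_1)
qed

text \<open>For \<open>s < d\<close> the recurrence determines \<open>y s\<close> from
  \<open>y 0\<close> and gives the summand as \<open>y 0 * wz_term q q s\<close>. With
  \<open>d = 2*m+1\<close>, terms with \<open>m < s\<close> vanish, so every cutoff
  \<open>m <= r < d\<close> reduces to \<open>wz_sum_root\<close>.\<close>

lemma block_sum:
  fixes q :: "'a::field"
  assumes d: "odd d" and root: "\<And>i. q ^ i = 1 \<longleftrightarrow> d dvd i"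
    and rec: "\<And>s. (1 - q^(s+1))^3 * (1 + q^(s+1)) * q^(s+1) * y (s+1) = (1 - q^(2*s+1))^3 * y s"
    and r: "r < d" "d \<le> 2*r+1"
  shows "(\<Sum>s\<le>r. (1 - q^(3*s+1)) * y s) = 0"
proof -
  obtain m where m: "d = 2*m+1" using d by (auto elim: oddE)
  have q0: "q \<noteq> 0"
  proof
    assume "q = 0" moreover have "q ^ d = 1" using root by simp
    ultimately show False using m by simp
  qed
  have y: "y s = y 0 * (wz_coeff q s * (\<Prod>i<s. 1 - q * q^(2*i))\<^sup>2 / q ^ s)" if "s < d" for s
    using that
  proof (induction s)
    case (Suc s)
    have "\<not> d dvd s + 1" using Suc.prems by (auto dest!: dvd_imp_le)
    moreover have "\<not> d dvd 2 * (s + 1)"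
      using \<open>\<not> d dvd s + 1\<close> d by (subst coprime_dvd_mult_right_iff) auto
    ultimately have nz: "1 - q^(s+1) \<noteq> 0" "1 - q^(2*(s+1)) \<noteq> 0" by (simp_all only: root[symmetric], auto)
    have f: "1 - q^(2*(s+1)) = (1 - q^(s+1)) * (1 + q^(s+1))"
      by (rule one_minus_even_power)
    define z where "z = q ^ (s+1)"
    define u where "u = 1 - q ^ (2*s+1)"
    define p where "p = (\<Prod>i<s. 1 - q * q^(2*i))"
    have nz': "1 - z \<noteq> 0" "1 + z \<noteq> 0" using nz f by (auto simp: z_def)
    have z0: "z \<noteq> 0" using q0 by (simp add: z_def)
    have qs: "q ^ s = z / q" using q0 by (simp add: z_def)
    have "y (Suc s) = u^3 * y s / ((1 - z)^3 * (1 + z) * z)"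
      using rec[of s] nz' z0 unfolding z_def[symmetric] u_def[symmetric]
      by (simp add: nonzero_eq_divide_eq mult.commute)
    also have "y s = y 0 * (wz_coeff q s * p\<^sup>2 / q ^ s)" using Suc by (simp add: p_def)
    finally have 1: "y (Suc s) = u^3 * (y 0 * (wz_coeff q s * p\<^sup>2 / (z / q))) / ((1 - z)^3 * (1 + z) * z)"
      by (simp add: qs)
    have 2: "wz_coeff q (Suc s) = wz_coeff q s * (u / ((1 - z) * (1 + z) * (1 - z)\<^sup>2 * (z / q)))"
    proof -
      have "2 * (s+1) = 2*s + 2" by simp
      then have "1 - q ^ (2*s+2) = (1 - z) * (1 + z)" using f unfolding z_def by (simp only:)
      then show ?thesis unfolding wz_coeff_def prod.lessThan_Suc z_def[symmetric] u_def qs by (simp only:)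
    qed
    have 3: "(\<Prod>i<Suc s. 1 - q * q^(2*i)) = p * u" by (simp add: p_def u_def)
    have 4: "q ^ Suc s = z" by (simp add: z_def)
    show ?case unfolding 1 2 3 4
      by (simp add: power2_eq_square power3_eq_cube ac_simps)
  qed (simp add: wz_coeff_def)
  have w: "(1 - q^(3*s+1)) * y s = y 0 * wz_term q q s" if "s < d" for s
    using y[OF that] by (simp add: wz_term_def)
  \<comment> \<open>The factor \<open>i = m\<close> of \<open>wz_coeff q s\<close> has numerator
    \<open>1 - q^d = 0\<close>.\<close>
  have z: "wz_term q q s = 0" if "m < s" for s
  proof -
    have "q ^ d = 1" using root by simp
    then have "1 - q ^ (2*m+1) = 0" using m by simp
    then have "wz_coeff q s = 0" using that unfolding wz_coeff_def by (intro prod_zero) auto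
    then show ?thesis by (simp add: wz_term_def)
  qed
  have "(\<Sum>s\<le>r. (1 - q^(3*s+1)) * y s) = (\<Sum>s\<le>r. y 0 * wz_term q q s)"
    using r by (intro sum.cong refl w) auto
  also have "\<dots> = (\<Sum>s\<le>m. y 0 * wz_term q q s)"
    using r m z by (intro sum.mono_neutral_right) auto
  also have "\<dots> = 0" using wz_sum_root[OF m root] by (simp flip: sum_distrib_left)
  finally show ?thesis .
qed

text \<open>The coefficients of the recurrence have period \<open>d\<close>, so
  \<open>block_sum\<close> applies to each block with its own starting value. Full blocks are cut
  off at \<open>d - 1\<close>, the last one at \<open>N mod d\<close>; both cutoffs reach the middle
  of the block.\<close>

lemma blocks_sum:
  fixes q :: "'a::field"
  assumes d: "odd d" and root: "\<And>i. q ^ i = 1 \<longleftrightarrow> d dvd i"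
    and rec: "\<And>s. (1 - q^(s+1))^3 * (1 + q^(s+1)) * q^(s+1) * y (s+1) = (1 - q^(2*s+1))^3 * y s"
    and r: "d \<le> 2 * (N mod d) + 1"
  shows "(\<Sum>k\<le>N. (1 - q^(3*k+1)) * y k) = 0"
proof -
  have blk: "(\<Sum>s\<le>r. (1 - q^(3*(b*d+s)+1)) * y (b*d+s)) = 0" if "r < d" "d \<le> 2*r+1" for b r
  proof -
    have per: "q ^ (c*(b*d) + s) = q ^ s" for c s
      using root[of "c*(b*d)"] by (simp add: power_add)
    have "(\<Sum>s\<le>r. (1 - q^(3*s+1)) * y (b*d+s)) = 0"
    proof (rule block_sum[OF d root _ that])
      fix s
      show "(1 - q^(s+1))^3 * (1 + q^(s+1)) * q^(s+1) * y (b*d+(s+1)) = (1 - q^(2*s+1))^3 * y (b*d+s)"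
        using rec[of "b*d+s"] per[of 1 "s+1"] per[of 2 "2*s+1"]
        by (simp only: distrib_left mult_1 mult.assoc add.assoc)
    qed
    then show ?thesis by (simp only: per distrib_left add.assoc)
  qed
  let ?w = "\<lambda>k. (1 - q^(3*k+1)) * y k"
  let ?a = "N div d" and ?r = "N mod d"
  have d0: "0 < d" using d by (cases d) auto
  have "sum ?w {b*d..<b*d+d} = 0" for b
  proof -
    have "sum ?w {b*d..<b*d+d} = (\<Sum>s\<in>{0..<d}. ?w (s+b*d))"
      using sum.shift_bounds_nat_ivl[of ?w 0 "b*d" d] by (simp add: add.commute)
    also have "{0..<d} = {..d-1}" using d0 by auto
    finally show ?thesis using blk[of "d-1" b] d0 by (simp add: add.commute)
  qed
  then have "sum ?w {..<?a*d} = 0" unfolding sum.nat_group[symmetric] by simp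
  moreover have "sum ?w {?a*d..<?a*d+(?r+1)} = 0"
  proof -
    have "sum ?w {?a*d..<?a*d+(?r+1)} = (\<Sum>s\<in>{0..<?r+1}. ?w (s+?a*d))"
      using sum.shift_bounds_nat_ivl[of ?w 0 "?a*d" "?r+1"] by (simp add: add.commute)
    also have "{0..<?r+1} = {..?r}" by auto
    finally show ?thesis using blk[of ?r ?a] d0 r by (simp add: add.commute)
  qed
  moreover have "{..N} = {..<?a*d} \<union> {?a*d..<?a*d+(?r+1)}"
    using div_mult_mod_eq[of N d] unfolding set_eq_iff Un_iff atMost_iff lessThan_iff atLeastLessThan_iff
    by linarith
  ultimately show ?thesis by (simp only:, subst sum.union_disjoint) auto
qed

section \<open>Orders at complex roots of unity\<close>

abbreviation cpoly :: "rat poly \<Rightarrow> complex poly" where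
  "cpoly \<equiv> map_poly of_rat"

lemma cpoly_add: "cpoly (p + q) = cpoly p + cpoly q"
  by (simp add: poly_eq_iff coeff_map_poly of_rat_add)

lemma cpoly_uminus: "cpoly (- p) = - cpoly p"
  by (simp add: poly_eq_iff coeff_map_poly of_rat_minus)

lemma cpoly_diff: "cpoly (p - q) = cpoly p - cpoly q"
  by (simp add: poly_eq_iff coeff_map_poly of_rat_diff)

lemma cpoly_mult: "cpoly (p * q) = cpoly p * cpoly q"
  by (simp add: poly_eq_iff coeff_map_poly coeff_mult of_rat_sum of_rat_mult)

lemma cpoly_X: "cpoly [:0, 1:] = [:0, 1:]"
  by (simp add: map_poly_pCons)

lemma cpoly_power: "cpoly (p ^ k) = cpoly p ^ k"
  by (induction k) (simp_all add: cpoly_mult)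

lemma cpoly_sum: "cpoly (sum f A) = (\<Sum>x\<in>A. cpoly (f x))"
  by (induction A rule: infinite_finite_induct) (simp_all add: cpoly_add)

lemma cpoly_prod: "cpoly (prod f A) = (\<Prod>x\<in>A. cpoly (f x))"
  by (induction A rule: infinite_finite_induct) (simp_all add: cpoly_mult)

lemma cpoly_eq_0_iff: "cpoly p = 0 \<longleftrightarrow> p = 0"
  by (simp add: poly_eq_iff coeff_map_poly)

lemma degree_cpoly: "degree (cpoly p) = degree p"
  by (rule degree_map_poly) simp

lemmas cpoly_hom = cpoly_add cpoly_uminus cpoly_diff cpoly_mult cpoly_X cpoly_power cpoly_sum cpoly_prod

text \<open>Complex polynomials split, so divisibility is inclusion of root multisets, up to nonzero
  leading coefficients.\<close>

lemma dvd_of_order_le: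
  fixes p q :: "complex poly"
  assumes "p \<noteq> 0" "q \<noteq> 0" "\<And>z. order z p \<le> order z q"
  shows "p dvd q"
proof -
  have "proots p \<subseteq># proots q"
    using assms by (intro mset_subset_eqI) simp
  then have "(\<Prod>x\<in>#proots p. [:-x, 1:]) dvd (\<Prod>x\<in>#proots q. [:-x, 1:])"
    by (intro prod_mset_subset_imp_dvd image_mset_subseteq_mono)
  then have "smult (lead_coeff p) (\<Prod>x\<in>#proots p. [:-x, 1:]) dvd
      smult (lead_coeff q) (\<Prod>x\<in>#proots q. [:-x, 1:])"
    using assms by (simp add: smult_dvd_iff dvd_smult)
  then show ?thesis by (simp only: complex_poly_decompose_multiset)
qed

text \<open>Descent to the rationals: the remainder of \<open>q\<close> modulo \<open>p\<close>
  stays of smaller degree over the complex numbers, yet is divisible by \<open>cpoly p\<close>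
  there, so it is 0.\<close>

lemma dvd_of_cpoly_order_le:
  assumes "p \<noteq> 0" "\<And>z. q \<noteq> 0 \<Longrightarrow> order z (cpoly p) \<le> order z (cpoly q)"
  shows "p dvd q"
proof (cases "q = 0")
  case False
  have "cpoly p dvd cpoly q"
    using assms False by (intro dvd_of_order_le) (simp_all add: cpoly_eq_0_iff)
  moreover have "cpoly q = cpoly p * cpoly (q div p) + cpoly (q mod p)"
    by (simp flip: cpoly_mult cpoly_add)
  ultimately have "cpoly p dvd cpoly (q mod p)"
    by (metis dvd_add_right_iff dvd_triv_left)
  then have "q mod p = 0"
    using degree_mod_less'[OF assms(1), of q] dvd_imp_degree_le[of "cpoly p" "cpoly (q mod p)"]
    by (cases "q mod p = 0") (auto simp: cpoly_eq_0_iff degree_cpoly)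
  then show ?thesis by (simp add: dvd_eq_mod_eq_0)
qed simp

text \<open>If \<open>z\<close> is not a root of unity then \<open>d = 0\<close>, and division by \<open>0\<close> gives the right orders below.\<close>

lemma exists_mult_order:
  fixes z :: "'a::field"
  shows "\<exists>d. \<forall>i. z ^ i = 1 \<longleftrightarrow> d dvd i"
proof (cases "\<exists>i>0. z ^ i = 1")
  case True
  define d where "d = (LEAST i. i > 0 \<and> z ^ i = 1)"
  have d: "d > 0" "z ^ d = 1"
    using LeastI_ex[of "\<lambda>i. i > 0 \<and> z ^ i = 1"] True by (auto simp: d_def)
  have "z ^ i = 1 \<longleftrightarrow> d dvd i" for i
  proof -
    have "z ^ i = z ^ (i div d * d + i mod d)" by simp
    also have "\<dots> = z ^ (i mod d)"
      using d by (simp only: power_add power_mult mult.commute[of _ d]) simp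
    finally have "z ^ i = z ^ (i mod d)" .
    moreover have "z ^ (i mod d) = 1 \<longleftrightarrow> i mod d = 0"
      using not_less_Least[of "i mod d" "\<lambda>i. i > 0 \<and> z ^ i = 1"] d
      by (auto simp flip: d_def)
    ultimately show ?thesis by (simp add: dvd_eq_mod_eq_0)
  qed
  then show ?thesis by blast
next
  case False
  then have "z ^ i = 1 \<longleftrightarrow> 0 dvd i" for i by (metis dvd_0_left_iff power_0 neq0_conv)
  then show ?thesis by blast
qed

section \<open>Orders of q-factorials, Gaussian binomials and related factors\<close>

abbreviation X :: "rat poly" where "X \<equiv> [:0, 1:]"

lemma one_minus_power_nonzero:
  assumes "m > 0"
  shows "1 - X ^ m \<noteq> 0"
proof -
  have "poly (1 - X ^ m) 0 \<noteq> 0" using assms by (simp add: poly_power zero_power)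
  then show ?thesis by force
qed

text \<open>Roots are simple: the derivative \<open>- m X^(m-1)\<close> vanishes at no nonzero
  point.\<close>

lemma order_one_minus_power:
  fixes z :: complex
  assumes root: "\<And>i. z ^ i = 1 \<longleftrightarrow> d dvd i" and "m > 0"
  shows "order z (cpoly (1 - X ^ m)) = (if d dvd m then 1 else 0)"
proof -
  note nz = one_minus_power_nonzero[OF \<open>m > 0\<close>]
  have c: "cpoly (1 - X ^ m) = 1 - [:0,1:] ^ m" by (simp add: cpoly_hom)
  have ev: "poly (cpoly (1 - X ^ m)) z = 1 - z ^ m" by (simp add: c poly_power)
  show ?thesis
  proof (cases "d dvd m")
    case True
    then have 1: "z ^ m = 1" using root by simp
    have z0: "z \<noteq> 0" using 1 \<open>m > 0\<close> by (auto simp: zero_power)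
    have "pderiv (cpoly (1 - X ^ m)) = - smult (of_nat m) ([:0,1:] ^ (m-1) :: complex poly)"
      using \<open>m > 0\<close> unfolding c by (cases m) (simp_all add: pderiv_diff pderiv_power_Suc pderiv_pCons del: power_Suc)
    then have "poly (pderiv (cpoly (1 - X ^ m))) z \<noteq> 0"
      using z0 \<open>m > 0\<close> by (simp add: poly_power)
    then have "order z (pderiv (cpoly (1 - X ^ m))) = 0" by (rule order_0I)
    moreover have "order z (cpoly (1 - X ^ m)) \<noteq> 0"
      using ev 1 nz order_root[of "cpoly (1 - X ^ m)" z] by (simp add: cpoly_eq_0_iff)
    ultimately show ?thesis
      using True order_pderiv[of "cpoly (1 - X ^ m)" z] nz ev 1 by (simp add: cpoly_eq_0_iff)
  next
    case False
    then have "order z (cpoly (1 - X ^ m)) = 0" using ev root[of m] by (intro order_0I) auto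
    then show ?thesis using False by simp
  qed
qed

definition qfact :: "nat \<Rightarrow> rat poly" where
  "qfact m = q_pochhammer X X m"

lemma qfact_0: "qfact 0 = 1"
  by (simp add: qfact_def q_pochhammer_def)

lemma qfact_Suc: "qfact (Suc m) = qfact m * (1 - X ^ Suc m)"
  by (simp add: qfact_def q_pochhammer_def)

lemma qfact_nonzero: "qfact m \<noteq> 0"
proof (induction m)
  case (Suc m)
  from Suc one_minus_power_nonzero[of "Suc m"] show ?case
    unfolding qfact_Suc by (simp del: power_Suc)
qed (simp add: qfact_0)

lemma order_cpoly_mult:
  "p * q \<noteq> 0 \<Longrightarrow> order z (cpoly (p * q)) = order z (cpoly p) + order z (cpoly q)"
  by (subst cpoly_mult, rule order_mult) (simp add: cpoly_eq_0_iff)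

text \<open>The order counts the multiples of \<open>d\<close> among
  \<open>1, ..., m\<close>.\<close>

lemma order_qfact:
  fixes z :: complex
  assumes root: "\<And>i. z ^ i = 1 \<longleftrightarrow> d dvd i"
  shows "order z (cpoly (qfact m)) = m div d"
proof (induction m)
  case (Suc m)
  have "order z (cpoly (qfact (Suc m))) = m div d + order z (cpoly (1 - X ^ Suc m))"
    using order_cpoly_mult[of "qfact m" "1 - X ^ Suc m" z] qfact_nonzero[of "Suc m"] Suc
    unfolding qfact_Suc by simp
  also have "\<dots> = Suc m div d"
    by (subst order_one_minus_power[OF root]) (auto simp: div_Suc dvd_eq_mod_eq_0)
  finally show ?case .
qed (simp add: qfact_0)

text \<open>For \<open>k <= m\<close> this polynomial division is exact, by
  \<open>gauss_mult\<close>.\<close>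

definition gauss :: "nat \<Rightarrow> nat \<Rightarrow> rat poly" where
  "gauss m k = qfact m div (qfact k * qfact (m - k))"

text \<open>By orders, this is the superadditivity of \<open>x div d\<close> in
  \<open>x\<close>.\<close>

lemma gauss_mult:
  assumes "k \<le> m"
  shows "gauss m k * (qfact k * qfact (m - k)) = qfact m"
proof -
  have "qfact k * qfact (m - k) dvd qfact m"
  proof (rule dvd_of_cpoly_order_le)
    fix z :: complex
    obtain d where root: "z ^ i = 1 \<longleftrightarrow> d dvd i" for i using exists_mult_order[of z] by blast
    have "k div d + (m - k) div d \<le> (k + (m - k)) div d"
      by (subst div_add1_eq) simp
    then show "order z (cpoly (qfact k * qfact (m - k))) \<le> order z (cpoly (qfact m))"
      using assms by (subst order_cpoly_mult) (simp_all add: order_qfact[OF root] qfact_nonzero)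
  qed (simp add: qfact_nonzero)
  then show ?thesis by (simp add: gauss_def)
qed

lemma gauss_nonzero: "k \<le> m \<Longrightarrow> gauss m k \<noteq> 0"
  using gauss_mult qfact_nonzero by (metis mult_zero_left)

text \<open>Stated additively to avoid truncated subtraction, as are the two order formulas that
  follow.\<close>

lemma order_gauss:
  fixes z :: complex
  assumes root: "\<And>i. z ^ i = 1 \<longleftrightarrow> d dvd i" and "k \<le> m"
  shows "order z (cpoly (gauss m k)) + (k div d + (m - k) div d) = m div d"
proof -
  have "order z (cpoly (gauss m k * (qfact k * qfact (m - k)))) = m div d"
    using assms by (simp add: gauss_mult order_qfact)
  then show ?thesis
    using assms by (simp add: order_cpoly_mult gauss_nonzero qfact_nonzero order_qfact[OF root])
qed

lemma q_int_mult: "q_int q m * (1 - q) = 1 - q ^ m"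
  by (simp add: q_int_def one_diff_power_eq mult.commute)

lemma order_q_int:
  fixes z :: complex
  assumes root: "\<And>i. z ^ i = 1 \<longleftrightarrow> d dvd i" and "m > 0"
  shows "q_int X m \<noteq> 0"
    "order z (cpoly (q_int X m)) + of_bool (d = 1) = of_bool (d dvd m)"
proof -
  have 1: "1 - X ^ 1 \<noteq> 0" "1 - X ^ m \<noteq> 0" using \<open>m > 0\<close> by (intro one_minus_power_nonzero; simp)+
  have eq: "q_int X m * (1 - X ^ 1) = 1 - X ^ m" using q_int_mult[of X m] by simp
  then show nz: "q_int X m \<noteq> 0" using 1 by auto
  show "order z (cpoly (q_int X m)) + of_bool (d = 1) = of_bool (d dvd m)"
    using order_cpoly_mult[of "q_int X m" "1 - X ^ 1" z] 1 nz \<open>m > 0\<close>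
    unfolding eq by (simp add: order_one_minus_power[OF root] order_one_minus_power[OF root, of 1, simplified] of_bool_def)
qed

lemma order_one_plus_power:
  fixes z :: complex
  assumes root: "\<And>i. z ^ i = 1 \<longleftrightarrow> d dvd i" and "m > 0"
  shows "1 + X ^ m \<noteq> 0"
    "order z (cpoly (1 + X ^ m)) + of_bool (d dvd m) = of_bool (d dvd 2 * m)"
proof -
  have 1: "1 - X ^ m \<noteq> 0" "1 - X ^ (2*m) \<noteq> 0" using \<open>m > 0\<close> by (intro one_minus_power_nonzero; simp)+
  have eq: "(1 + X ^ m) * (1 - X ^ m) = 1 - X ^ (2*m)"
    by (subst one_minus_even_power) (rule mult.commute)
  then show nz: "1 + X ^ m \<noteq> 0" using 1 by auto
  show "order z (cpoly (1 + X ^ m)) + of_bool (d dvd m) = of_bool (d dvd 2 * m)"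
    using order_cpoly_mult[of "1 + X ^ m" "1 - X ^ m" z] 1 nz \<open>m > 0\<close>
    unfolding eq by (simp add: order_one_minus_power[OF root] of_bool_def)
qed

text \<open>Division-free, so that it can be evaluated at roots of unity where
  \<open>1 - X^(k+1)\<close> vanishes.\<close>

lemma gauss_central_rec:
  "(1 - X ^ (k+1)) * gauss (2 * (k+1)) (k+1) = (1 - X ^ (2*k+1)) * (1 + X ^ (k+1)) * gauss (2*k) k"
proof -
  let ?Q = "qfact k * qfact k * (1 - X ^ (k+1))"
  have 1: "gauss (2*(k+1)) (k+1) * (qfact (k+1) * qfact (k+1)) = qfact (2*k) * (1 - X ^ (2*k+1)) * (1 - X ^ (2*(k+1)))"
    using gauss_mult[of "k+1" "2*(k+1)"] by (simp add: qfact_Suc mult.assoc del: power_Suc)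
  have 2: "gauss (2*k) k * (qfact k * qfact k) = qfact (2*k)"
    using gauss_mult[of k "2*k"] by simp
  have 3: "1 - X ^ (2*(k+1)) = (1 - X ^ (k+1)) * (1 + X ^ (k+1))"
    by (rule one_minus_even_power)
  have 4: "qfact (k+1) = qfact k * (1 - X ^ (k+1))" by (simp add: qfact_Suc)
  have "((1 - X ^ (k+1)) * gauss (2 * (k+1)) (k+1)) * ?Q =
     gauss (2*(k+1)) (k+1) * (qfact (k+1) * qfact (k+1))"
    unfolding 4 by (simp only: ac_simps)
  also have "\<dots> = ((1 - X ^ (2*k+1)) * (1 + X ^ (k+1)) * gauss (2*k) k) * ?Q"
    unfolding 1 3 2[symmetric] by (simp only: ac_simps)
  finally have "((1 - X ^ (k+1)) * gauss (2 * (k+1)) (k+1)) * ?Q =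
    ((1 - X ^ (2*k+1)) * (1 + X ^ (k+1)) * gauss (2*k) k) * ?Q" .
  moreover have "?Q \<noteq> 0" using qfact_nonzero[of k] qfact_nonzero[of "k+1"] unfolding 4 by auto
  ultimately show ?thesis by (simp only: mult_cancel_right) simp
qed

section \<open>Divisibility by the modulus\<close>

lemma double_div_mod: "2 * m = 2 * (m div d) * d + 2 * (m mod d)" for m d :: nat
  using arg_cong[OF div_mult_mod_eq[of m d], of "\<lambda>x. 2 * x"] by (simp only: distrib_left mult.assoc)

text \<open>For \<open>d >= 2\<close> and \<open>r = m mod d\<close>, the q-integer and the Gaussian
  binomial together have order \<open>(2*r+1) div d <= 1\<close>. The squared factor adds at most 2,
  and nothing for odd \<open>d\<close>.\<close>

lemma order_modulus:
  fixes z :: complex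
  assumes root: "\<And>i. z ^ i = 1 \<longleftrightarrow> d dvd i" and "m > 0"
  defines "M \<equiv> (1 + X ^ m)\<^sup>2 * q_int X (Suc m) * gauss (2 * m + 1) m"
  shows "M \<noteq> 0"
    "order z (cpoly M) \<le> (if 2 \<le> d \<and> d \<le> 2 * (m mod d) + 1 then if odd d then 1 else 3 else 0)"
proof -
  define o1 where "o1 = order z (cpoly (1 + X ^ m))"
  define o2 where "o2 = order z (cpoly (q_int X (Suc m)))"
  define o3 where "o3 = order z (cpoly (gauss (2 * m + 1) m))"
  have nz: "1 + X ^ m \<noteq> 0" "q_int X (Suc m) \<noteq> 0" "gauss (2 * m + 1) m \<noteq> 0"
    using order_one_plus_power(1)[OF root \<open>m > 0\<close>] order_q_int(1)[OF root, of "Suc m"]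
    by (simp_all add: gauss_nonzero)
  then show "M \<noteq> 0" by (simp add: M_def)
  have ord: "order z (cpoly M) = 2 * o1 + o2 + o3"
    using nz unfolding M_def power2_eq_square by (simp add: order_cpoly_mult o1_def o2_def o3_def)
  have o1: "o1 + of_bool (d dvd m) = of_bool (d dvd 2 * m)"
    unfolding o1_def by (rule order_one_plus_power(2)[OF root \<open>m > 0\<close>])
  have o2: "o2 + of_bool (d = 1) = of_bool (d dvd Suc m)"
    unfolding o2_def by (rule order_q_int(2)[OF root]) simp
  have o3: "o3 + (m div d + Suc m div d) = (2 * m + 1) div d"
    using order_gauss[OF root, of m "2*m+1"] by (simp add: o3_def)
  \<comment> \<open>\<open>d = 0\<close> means that \<open>z\<close> is no root of unity,
    \<open>d = 1\<close> that \<open>z = 1\<close>; no factor vanishes in either case.\<close>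
  consider "d = 0" | "d = 1" | "d \<ge> 2" by linarith
  then show "order z (cpoly M) \<le> (if 2 \<le> d \<and> d \<le> 2 * (m mod d) + 1 then if odd d then 1 else 3 else 0)"
  proof cases
    case 1
    then show ?thesis using o1 o2 o3 \<open>m > 0\<close> by (simp add: ord)
  next
    case 2
    then show ?thesis using o1 o2 o3 by (simp add: ord)
  next
    case 3
    let ?r = "m mod d"
    have "2 * m + 1 = 2 * (m div d) * d + (2 * ?r + 1)"
      using double_div_mod[of m d] by simp
    then have "(2 * m + 1) div d = 2 * (m div d) + (2 * ?r + 1) div d"
      using 3 by (simp only:, subst div_mult_self3) auto
    moreover have "Suc m div d = m div d + of_bool (d dvd Suc m)"
      by (simp add: div_Suc dvd_eq_mod_eq_0)
    \<comment> \<open>The extra 1 in \<open>Suc m div d\<close> when \<open>d\<close> divides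
      \<open>m + 1\<close> is exactly \<open>o2\<close>.\<close>
    ultimately have o23: "o2 + o3 = (2 * ?r + 1) div d" using o2 o3 3 by simp
    have r: "?r < d" using 3 by simp
    have "(2 * ?r + 1) div d < 2" using r by (subst div_less_iff_less_mult) auto
    then have o23': "o2 + o3 \<le> 1" using o23 by simp
    have o1': "o1 \<le> 1" using o1 by (auto split: if_splits simp: of_bool_def)
    show ?thesis
    proof (cases "d \<le> 2 * ?r + 1")
      case True
      have "o1 = 0" if "odd d"
        using o1 that coprime_dvd_mult_right_iff[of d 2 m] by simp
      then show ?thesis using True 3 o1' o23' by (auto simp: ord)
    next
      case False
      \<comment> \<open>Here \<open>2 * ?r < d\<close>, so \<open>d\<close> can divide
        \<open>2 * ?r\<close> only if \<open>?r = 0\<close>.\<close>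
      have "d dvd m" if "d dvd 2 * m"
      proof -
        have "2 * m = d * (2 * (m div d)) + 2 * ?r"
          using double_div_mod[of m d] by (simp only: ac_simps)
        with that have "d dvd 2 * ?r"
          by (metis dvd_add_right_iff dvd_triv_left)
        then have "?r = 0" using False by (cases "?r = 0") (auto dest!: dvd_imp_le)
        then show ?thesis by (simp add: dvd_eq_mod_eq_0)
      qed
      then have "o1 = 0" using o1 by (auto simp: of_bool_def split: if_splits)
      moreover have "o2 + o3 = 0" using o23 False by simp
      ultimately show ?thesis by (simp add: ord)
    qed
  qed
qed

text \<open>The power of \<open>q\<close> in the denominator is cleared by the common factor \<open>q\<close> to the \<open>(m + 1 choose 2)\<close>.\<close>

definition summand :: "nat \<Rightarrow> nat \<Rightarrow> rat poly" where
  "summand m k = q_int X (3 * k + 1) * gauss (2 * k) k ^ 3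
     * q_pochhammer (- (X ^ (k + 1))) X (m - k) ^ 4 * X ^ ((Suc m choose 2) - (k + 1 choose 2))"

section \<open>Vanishing of the summands, and of their sum, at roots of the modulus\<close>

lemma prod_lessThan_add:
  fixes f :: "nat \<Rightarrow> 'a::comm_monoid_mult"
  shows "prod f {..<k + j} = prod f {..<k} * (\<Prod>i<j. f (k + i))"
  by (induction j) (simp_all add: mult.assoc)

lemma q_pochhammer_minus:
  "q_pochhammer (- (q ^ (k + 1))) q j = (\<Prod>i<j. 1 + q ^ (k + 1 + i))"
  by (simp add: q_pochhammer_def power_add mult.assoc)

text \<open>Let \<open>h = d/2\<close>. If \<open>k mod d >= h\<close>, adding \<open>k\<close> to
  itself carries modulo \<open>d\<close>, so the cubed Gaussian binomial vanishes. Otherwise some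
  \<open>i\<close> with \<open>k < i <= m\<close> has \<open>z^i = -1\<close>, and the fourth power
  vanishes.\<close>

lemma summand_cube_dvd:
  fixes z :: complex
  assumes root: "\<And>i. z ^ i = 1 \<longleftrightarrow> d dvd i" and d: "even d" "d \<ge> 2" "d \<le> 2 * (m mod d) + 1"
    and "k \<le> m"
  shows "[:-z, 1:] ^ 3 dvd cpoly (summand m k)"
proof (cases "d \<le> 2 * (k mod d)")
  case True
  have "2 * k = 2 * (k div d) * d + 2 * (k mod d)"
    by (rule double_div_mod)
  then have "2 * k div d = 2 * (k div d) + 2 * (k mod d) div d"
    using d by (simp only:) simp
  moreover have "2 * (k mod d) div d \<noteq> 0" using True d by (simp add: div_eq_0_iff)
  ultimately have "order z (cpoly (gauss (2 * k) k)) \<noteq> 0"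
    using order_gauss[OF root, of k "2*k"] by (simp add: mult_2)
  then have "poly (cpoly (gauss (2 * k) k)) z = 0" by (simp add: order_root)
  then have "[:-z, 1:] ^ 3 dvd cpoly (gauss (2 * k) k) ^ 3"
    by (intro dvd_power_same) (simp add: poly_eq_0_iff_dvd)
  then show ?thesis unfolding summand_def cpoly_mult cpoly_power
    by (intro dvd_mult2 dvd_mult)
next
  case False
  define h where "h = d div 2"
  \<comment> \<open>The least exponent above \<open>k\<close> at which the power of \<open>z\<close>
    is -1.\<close>
  define i where "i = k div d * d + h"
  have h: "d = 2 * h" "h > 0" using d by (auto simp: h_def)
  have ki: "k < i" using False h div_mult_mod_eq[of k d] unfolding i_def by linarith
  have "k div d * d \<le> m div d * d" using \<open>k \<le> m\<close> by (intro mult_right_mono div_le_mono) auto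
  \<comment> \<open>As \<open>d\<close> is even, \<open>d <= 2 * (m mod d) + 1\<close> amounts to
    this bound, which keeps \<open>i\<close> within \<open>m\<close>.\<close>
  moreover have "h \<le> m mod d" using h(1) d(3) by linarith
  ultimately have im: "i \<le> m" using div_mult_mod_eq[of m d] unfolding i_def by linarith
  have "z ^ h \<noteq> 1" using h by (auto simp: root dest: dvd_imp_le)
  moreover have "(z ^ h)\<^sup>2 = 1" using root[of d] h(1) by (simp add: power_mult[symmetric] mult.commute)
  ultimately have "z ^ h = -1" by (simp add: power2_eq_1_iff)
  moreover have "z ^ (k div d * d) = 1" by (simp add: root)
  ultimately have "z ^ i = -1" by (simp add: i_def power_add)
  then have "poly (cpoly (1 + X ^ i)) z = 0" by (simp add: cpoly_hom poly_power)
  then have "[:-z, 1:] dvd cpoly (1 + X ^ i)" by (simp add: poly_eq_0_iff_dvd)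
  also have "\<dots> dvd cpoly (q_pochhammer (- (X ^ (k + 1))) X (m - k))"
  proof -
    have "cpoly (1 + X ^ (k + 1 + (i - k - 1))) dvd (\<Prod>j<m - k. cpoly (1 + X ^ (k + 1 + j)))"
      by (rule dvd_prodI) (use ki im in auto)
    moreover have "k + 1 + (i - k - 1) = i" using ki by simp
    ultimately show ?thesis unfolding q_pochhammer_minus cpoly_prod by (simp only:)
  qed
  finally have "[:-z, 1:] ^ 4 dvd cpoly (q_pochhammer (- (X ^ (k + 1))) X (m - k)) ^ 4"
    by (rule dvd_power_same)
  moreover have "[:-z, 1:] ^ 3 dvd [:-z, 1:] ^ 4" by (rule le_imp_power_dvd) simp
  ultimately have "[:-z, 1:] ^ 3 dvd cpoly (q_pochhammer (- (X ^ (k + 1))) X (m - k)) ^ 4"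
    by (rule dvd_trans[rotated])
  then show ?thesis unfolding summand_def cpoly_mult cpoly_power
    by (intro dvd_mult2 dvd_mult)
qed

text \<open>After multiplication by \<open>1 - z\<close> and removal of a nonzero factor independent
  of \<open>k\<close>, the sum has the shape treated in \<open>blocks_sum\<close>.\<close>

lemma summand_sum_root:
  fixes z :: complex
  assumes root: "\<And>i. z ^ i = 1 \<longleftrightarrow> d dvd i" and d: "odd d" "d \<ge> 2" "d \<le> 2 * (m mod d) + 1"
  shows "poly (cpoly (\<Sum>k\<le>m. summand m k)) z = 0"
proof -
  define ev where "ev p = poly (cpoly p) z" for p
  have ev: "ev (p + q) = ev p + ev q" "ev (p - q) = ev p - ev q" "ev (p * q) = ev p * ev q" "ev 1 = 1"
    "ev (p ^ k) = ev p ^ k" "ev X = z" for p q k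
    by (simp_all add: ev_def cpoly_hom poly_power)
  have ev_sum: "ev (sum f A) = (\<Sum>x\<in>A. ev (f x))" for f :: "nat \<Rightarrow> _" and A
    by (simp add: ev_def cpoly_hom poly_sum)
  have ev_prod: "ev (prod f A) = (\<Prod>x\<in>A. ev (f x))" for f :: "nat \<Rightarrow> _" and A
    by (simp add: ev_def cpoly_hom poly_prod)
  have z0: "z \<noteq> 0"
  proof
    assume "z = 0" moreover have "z ^ d = 1" using root by simp
    ultimately show False using d by (simp add: zero_power)
  qed
  have z1: "z \<noteq> 1" using root[of 1] d by auto
  define P where "P k = (\<Prod>i<k. 1 + z ^ (i+1))" for k
  define B where "B k = ev (gauss (2*k) k)" for k
  \<comment> \<open>The Pochhammer factor, a product over the exponents from \<open>k + 1\<close> to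
    \<open>m\<close>, equals \<open>P m / P k\<close>; \<open>y\<close> keeps the part depending on
    \<open>k\<close>.\<close>
  define y where "y k = B k ^ 3 / (P k ^ 4 * z ^ (k + 1 choose 2))" for k
  \<comment> \<open>A root of unity of odd order has no power equal to -1.\<close>
  have plus: "1 + z ^ i \<noteq> 0" for i
  proof
    assume "1 + z ^ i = 0"
    then have *: "z ^ i = -1" by (simp add: add_eq_0_iff)
    then have "z ^ (2 * i) = 1" by (simp add: mult.commute[of 2] power_mult)
    then have "d dvd i" using d coprime_dvd_mult_right_iff[of d 2 i] by (simp add: root)
    then show False using * root[of i] by simp
  qed
  have P0: "P k \<noteq> 0" for k using plus by (simp add: P_def del: power_Suc)
  \<comment> \<open>Passing from \<open>s\<close> to \<open>s + 1\<close>, the cubed binomial gains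
    \<open>(1 + w)^3\<close>, while the denominator gains \<open>(1 + w)^4\<close> and
    \<open>w\<close>; this explains the factors \<open>1 + w\<close> and \<open>w\<close> on the
    left.\<close>
  have rec: "(1 - z^(s+1))^3 * (1 + z^(s+1)) * z^(s+1) * y (s+1) = (1 - z^(2*s+1))^3 * y s" for s
  proof -
    define w where "w = z ^ (s+1)"
    define u where "u = 1 - z ^ (2*s+1)"
    define E where "E = z ^ (s + 1 choose 2)"
    have nz: "w \<noteq> 0" "E \<noteq> 0" "1 + w \<noteq> 0" using z0 plus[of "s+1"] by (simp_all add: w_def E_def)
    have B: "(1 - w) * B (s+1) = u * (1 + w) * B s"
      unfolding w_def u_def B_def using gauss_central_rec[of s, THEN arg_cong, of ev] unfolding ev .
    have P: "P (s+1) = P s * (1 + w)" by (simp add: P_def w_def)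
    have "Suc (s + 1) choose 2 = (s + 1) + (s + 1 choose 2)"
      by (simp add: numeral_2_eq_2)
    then have E: "z ^ (s + 1 + 1 choose 2) = w * E" by (simp add: power_add w_def E_def)
    have "(1 - w)^3 * (1 + w) * w * y (s+1) = ((1 - w) * B (s+1))^3 * ((1 + w) * w) / (P (s+1) ^ 4 * (w * E))"
      unfolding y_def E by (simp add: power_mult_distrib)
    also have "\<dots> = u^3 * ((1 + w) ^ 4 * w * B s ^ 3) / (P s ^ 4 * (1 + w) ^ 4 * (w * E))"
      unfolding B P power_mult_distrib by (simp add: power3_eq_cube power4_eq_xxxx)
    also have "\<dots> = u^3 * y s" using nz P0[of s] unfolding y_def E_def[symmetric] by simp
    finally show ?thesis unfolding w_def u_def .
  qed
  have summand_eq: "(1 - z) * ev (summand m k) = P m ^ 4 * z ^ (Suc m choose 2) * ((1 - z ^ (3*k+1)) * y k)"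
    if "k \<le> m" for k
  proof -
    have "ev (q_int X (3*k+1)) * (1 - z) = 1 - z ^ (3*k+1)"
      using q_int_mult[of X "3*k+1", THEN arg_cong, of ev] unfolding ev .
    then have 1: "(1 - z) * ev (q_int X (3*k+1)) = 1 - z ^ (3*k+1)" by (simp only: mult.commute)
    have "P m = P (k + (m - k))" using that by simp
    also have "\<dots> = P k * ev (q_pochhammer (- (X ^ (k + 1))) X (m - k))"
      unfolding q_pochhammer_minus ev_prod ev P_def
      by (subst prod_lessThan_add) (simp add: ac_simps)
    finally have 2: "ev (q_pochhammer (- (X ^ (k + 1))) X (m - k)) = P m / P k"
      using P0[of k] by (simp add: field_simps)
    have "k + 1 choose 2 \<le> Suc m choose 2" using that by (intro binomial_right_mono) simp
    then have 3: "z ^ ((Suc m choose 2) - (k + 1 choose 2)) = z ^ (Suc m choose 2) / z ^ (k + 1 choose 2)"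
      using z0 by (rule power_diff[rotated])
    have "(1 - z) * ev (summand m k) = (1 - z ^ (3*k+1)) * B k ^ 3 * (P m / P k) ^ 4 *
       (z ^ (Suc m choose 2) / z ^ (k + 1 choose 2))"
      unfolding summand_def ev 2 3 1[symmetric] B_def by (simp only: mult.assoc)
    then show ?thesis by (simp add: y_def power_divide)
  qed
  have "(1 - z) * ev (\<Sum>k\<le>m. summand m k) = P m ^ 4 * z ^ (Suc m choose 2) * (\<Sum>k\<le>m. (1 - z ^ (3*k+1)) * y k)"
    unfolding ev_sum sum_distrib_left by (intro sum.cong refl summand_eq) simp
  also have "\<dots> = 0" using blocks_sum[OF d(1) root rec d(3)] by simp
  finally show ?thesis using z1 by (simp add: ev_def)
qed

lemma modulus_dvd_summand_sum:
  assumes "m > 0"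
  shows "(1 + X ^ m)\<^sup>2 * q_int X (Suc m) * gauss (2 * m + 1) m dvd (\<Sum>k\<le>m. summand m k)"
    (is "?M dvd ?S")
proof (rule dvd_of_cpoly_order_le)
  \<comment> \<open>That the modulus is nonzero does not depend on the point; 1 serves only to
    instantiate \<open>order_modulus\<close>.\<close>
  obtain d where "(1::complex) ^ i = 1 \<longleftrightarrow> d dvd i" for i using exists_mult_order[of 1] by blast
  from order_modulus(1)[OF this assms] show "?M \<noteq> 0" .
next
  fix z :: complex
  assume S: "?S \<noteq> 0"
  then have S': "cpoly ?S \<noteq> 0" by (simp add: cpoly_eq_0_iff)
  obtain d where root: "z ^ i = 1 \<longleftrightarrow> d dvd i" for i using exists_mult_order[of z] by blast
  note le = order_modulus(2)[OF root assms]
  consider "\<not> (2 \<le> d \<and> d \<le> 2 * (m mod d) + 1)" | "2 \<le> d" "d \<le> 2 * (m mod d) + 1" "odd d"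
    | "2 \<le> d" "d \<le> 2 * (m mod d) + 1" "even d" by blast
  then show "order z (cpoly ?M) \<le> order z (cpoly ?S)"
  proof cases
    case 1
    then show ?thesis using le unfolding if_not_P[OF 1] by linarith
  next
    case 2
    have "order z (cpoly ?S) \<noteq> 0"
      using summand_sum_root[OF root 2(3,1,2)] S' by (simp add: order_root)
    then show ?thesis using le 2 by simp
  next
    case 3
    have "[:-z, 1:] ^ 3 dvd cpoly ?S" unfolding cpoly_sum
      using summand_cube_dvd[OF root 3(3,1,2)] by (intro dvd_sum) simp
    then have "3 \<le> order z (cpoly ?S)" using S' by (simp add: order_divides)
    then show ?thesis using le 3 by simp
  qed
qed

section \<open>Return to rational functions\<close>

lemma to_fract_power: "to_fract (a ^ k) = to_fract a ^ k"
  by (induction k) simp_all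

lemma to_fract_prod: "to_fract (prod f A) = (\<Prod>x\<in>A. to_fract (f x))"
  by (induction A rule: infinite_finite_induct) simp_all

lemma to_fract_q_pochhammer: "to_fract (q_pochhammer a q m) = q_pochhammer (to_fract a) (to_fract q) m"
  by (simp add: q_pochhammer_def to_fract_prod to_fract_power)

lemma to_fract_q_int: "to_fract (q_int q m) = q_int (to_fract q) m"
  by (simp add: q_int_def to_fract_power)

lemma to_fract_gauss:
  assumes "k \<le> m"
  shows "to_fract (gauss m k) = q_binomial (to_fract X) m k"
proof -
  have "to_fract (gauss m k) * (to_fract (qfact k) * to_fract (qfact (m - k))) = to_fract (qfact m)"
    using gauss_mult[OF assms] by (simp flip: to_fract_mult)
  then have "to_fract (gauss m k) = to_fract (qfact m) / (to_fract (qfact k) * to_fract (qfact (m - k)))"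
    by (simp add: nonzero_eq_divide_eq qfact_nonzero)
  then show ?thesis using assms by (simp add: q_binomial_def qfact_def to_fract_q_pochhammer)
qed

text \<open>With \<open>a\<close> the constant term of \<open>p\<close>, a common divisor of
  \<open>p\<close> and \<open>X^(k+1)\<close> divides \<open>a X^k\<close>, hence \<open>X^k\<close>
  since \<open>a\<close> is a unit; then induction applies.\<close>

lemma coprime_X_power:
  assumes "poly p 0 \<noteq> 0"
  shows "coprime (X ^ k) p"
proof (induction k)
  case (Suc k)
  show ?case
  proof (rule coprimeI)
    fix c assume c: "c dvd X ^ Suc k" "c dvd p"
    obtain a p' where p: "p = pCons a p'" by (cases p)
    have "[:a:] = p - X * p'" by (simp add: p)
    then have "[:a:] * X ^ k = p * X ^ k - X ^ Suc k * p'"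
      by (simp only: left_diff_distrib right_diff_distrib power_Suc ac_simps)
    then have "c dvd [:a:] * X ^ k" using c by (simp only:) (intro dvd_diff dvd_mult2)
    moreover have "is_unit [:a:]" using assms p by (simp add: is_unit_const_poly_iff dvd_field_iff)
    ultimately have "c dvd X ^ k" by (simp only: dvd_mult_unit_iff')
    then show "is_unit c" by (rule coprime_common_divisor[OF Suc _ c(2)])
  qed
qed simp

lemma poly_qfact_0: "poly (qfact m) 0 = 1"
  by (induction m) (simp_all add: qfact_0 qfact_Suc poly_power)

lemma poly_gauss_0: "k \<le> m \<Longrightarrow> poly (gauss m k) 0 = 1"
  using gauss_mult[of k m, THEN arg_cong, of "\<lambda>p. poly p 0"] by (simp add: poly_qfact_0)

theorem theorem1p3:
  fixes n :: nat and q :: "rat poly fract"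
  defines "q \<equiv> q_indet"
  assumes "n \<ge> 2"
  shows "ratfun_cong
    (\<Sum>k = 0..n - 1. q_int q (3 * k + 1) * q_binomial q (2 * k) k ^ 3
        * q_pochhammer (- (q ^ (k + 1))) q (n - k - 1) ^ 4
        * q powi (- int ((k + 1) choose 2)))
    0
    ((1 + q ^ (n - 1))\<^sup>2 * q_int q n * q_binomial q (2 * n - 1) (n - 1))"
proof -
  obtain m where m: "n = Suc m" "m > 0" using assms(2) by (cases n) auto
  define M where "M = (1 + X ^ m)\<^sup>2 * q_int X (Suc m) * gauss (2 * m + 1) m"
  \<comment> \<open>The common denominator: the exponent is the value of
    \<open>k + 1 choose 2\<close> at the last index \<open>k = m\<close>.\<close>
  define V where "V = X ^ (Suc m choose 2)"
  have q: "q = to_fract X" by (simp add: q_def q_indet_def)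
  obtain U where U: "(\<Sum>k\<le>m. summand m k) = M * U"
    using modulus_dvd_summand_sum[OF m(2)] unfolding M_def by (auto elim: dvdE)
  have V: "to_fract V = q ^ (Suc m choose 2)" "V \<noteq> 0" by (simp_all add: V_def q to_fract_power)
  have q0: "q \<noteq> 0" by (simp add: q)
  have modulus: "(1 + q ^ (n - 1))\<^sup>2 * q_int q n * q_binomial q (2 * n - 1) (n - 1) = to_fract M"
    by (simp add: M_def m q to_fract_power to_fract_q_int to_fract_gauss)
  have summand_eq: "q_int q (3 * k + 1) * q_binomial q (2 * k) k ^ 3
        * q_pochhammer (- (q ^ (k + 1))) q (n - k - 1) ^ 4
        * q powi (- int ((k + 1) choose 2)) = to_fract (summand m k) / to_fract V" if "k \<le> m" for k
  proof -
    have "k + 1 choose 2 \<le> Suc m choose 2" using that by (intro binomial_right_mono) simp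
    then have "q ^ ((Suc m choose 2) - (k + 1 choose 2)) = q ^ (Suc m choose 2) / q ^ (k + 1 choose 2)"
      using q0 by (rule power_diff[rotated])
    then have "q powi (- int ((k + 1) choose 2)) = q ^ ((Suc m choose 2) - (k + 1 choose 2)) / to_fract V"
      using q0 by (simp only: V power_int_minus power_int_of_nat) (simp add: inverse_eq_divide)
    moreover have "n - k - 1 = m - k" by (simp add: m)
    moreover have "to_fract (gauss (2 * k) k) = q_binomial q (2 * k) k"
      by (simp add: to_fract_gauss q)
    ultimately show ?thesis
      unfolding summand_def
      by (simp only: to_fract_mult to_fract_uminus to_fract_power to_fract_q_int to_fract_q_pochhammer flip: q)
        (simp only: times_divide_eq_right)
  qed
  \<comment> \<open>Every factor of \<open>M\<close> has constant term 1, so \<open>M\<close> shares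
    no factor with the power \<open>V\<close> of the indeterminate.\<close>
  have "poly M 0 \<noteq> 0"
    using m(2) by (simp add: M_def poly_gauss_0 q_int_def poly_sum poly_power zero_power power_0_left sum.If_cases)
  then have "coprime V M" unfolding V_def by (rule coprime_X_power)
  moreover have "(\<Sum>k = 0..n - 1. q_int q (3 * k + 1) * q_binomial q (2 * k) k ^ 3
        * q_pochhammer (- (q ^ (k + 1))) q (n - k - 1) ^ 4
        * q powi (- int ((k + 1) choose 2))) = to_fract (\<Sum>k\<le>m. summand m k) / to_fract V"
    unfolding to_fract_sum sum_divide_distrib using m
    by (intro sum.cong summand_eq) auto
  ultimately show ?thesis unfolding ratfun_cong_def modulus U using V(2) by auto
qed

end
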